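(* For every integer $n\ge0$, $$(-1)^n\sum_{k=0}^n S(n,k)(-1)^k D_k = \sum_{k=0}^n\binom{n}{k}(-1)^k b_k = 1 + \sum_{j=0}^{n-1}(-1)^{j+1}b_j.$$
   Context: $S(n,k)$ are the Stirling numbers of the second kind. $D_n = n!\left(1-\frac1{1!}+\frac1{2!}-\dots+\frac{(-1)^n}{n!}\right)$ are the derangement numbers (with exponential generating function $\frac{e^{-x}}{1-x}$). $b_n=\sum_{k=0}^n S(n,k)$ are the Bell numbers. *)

theory Defs
  imports Complex_Main "HOL-Combinatorics.Stirling"
begin

definition bell :: "nat \<Rightarrow> nat" where
  "bell n = (\<Sum>k\<le>n. Stirling n k)"

definition derangement_number :: "nat \<Rightarrow> real" where
  "derangement_number n = fact n * (\<Sum>k\<le>n. (-1) ^ k / fact k)"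

end

theory Submission
  imports Defs
begin

text \<open>
  The recurrence of the Stirling numbers turns \<open>\<Sum>k. S(n+1,k) f(k)\<close> into
  \<open>\<Sum>k. S(n,k) (k f(k) + f(k+1))\<close>. For \<open>f(k) = (-1)^k D(k)\<close> the inner bracket is \<open>1 - f(k)\<close>,
  because \<open>D(k+1) = (k+1) D(k) + (-1)^(k+1)\<close>. Hence the left-hand sum \<open>c(n)\<close> satisfies
  \<open>c(n+1) = b(n) - c(n)\<close>, which telescopes to the right-hand side.
  The middle expression is an iterated difference of the Bell numbers. Its increment is
  \<open>-(\<Sum>k. (n choose k) (-1)^k b(k+1))\<close>, and this equals \<open>(-1)^(n+1) b(n)\<close> since
  \<open>S(n,m)\<close> is the \<open>n\<close>-th difference at \<open>0\<close> of \<open>k \<mapsto> S(k+1,m+1)\<close>.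
\<close>

lemma sum_Stirling_Suc:
  fixes f :: "nat \<Rightarrow> 'a::comm_semiring_1"
  shows "(\<Sum>k\<le>Suc n. of_nat (Stirling (Suc n) k) * f k)
    = (\<Sum>k\<le>n. of_nat (Stirling n k) * (of_nat k * f k + f (Suc k)))"
proof -
  have "(\<Sum>k\<le>Suc n. of_nat (Stirling (Suc n) k) * f k)
      = (\<Sum>k\<le>n. of_nat (Stirling (Suc n) (Suc k)) * f (Suc k))"
    by (subst sum.atMost_Suc_shift) simp
  also have "\<dots> = (\<Sum>k\<le>n. of_nat (Stirling n (Suc k)) * (of_nat (Suc k) * f (Suc k)))
      + (\<Sum>k\<le>n. of_nat (Stirling n k) * f (Suc k))"
    unfolding sum.distrib[symmetric]
    by (intro sum.cong refl) (simp only: Stirling.simps of_nat_add of_nat_mult algebra_simps)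
  \<comment> \<open>Reindexing from \<open>Suc k\<close> to \<open>k\<close> adds a term at
    \<open>0\<close>, killed by the factor \<open>of_nat k\<close>; the top term then drops out
    because \<open>Stirling n (Suc n) = 0\<close>.\<close>
  also have "(\<Sum>k\<le>n. of_nat (Stirling n (Suc k)) * (of_nat (Suc k) * f (Suc k)))
      = (\<Sum>k\<le>Suc n. of_nat (Stirling n k) * (of_nat k * f k))"
    by (subst sum.atMost_Suc_shift) simp
  also have "\<dots> = (\<Sum>k\<le>n. of_nat (Stirling n k) * (of_nat k * f k))"
    by simp
  finally show ?thesis
    by (simp add: sum.distrib distrib_left)
qed

lemma derangement_number_Suc:
  "derangement_number (Suc n) = real (Suc n) * derangement_number n + (-1) ^ Suc n"
proof -
  have "derangement_number (Suc n)
      = fact (Suc n) * (\<Sum>k\<le>n. (-1) ^ k / fact k) + fact (Suc n) * ((-1) ^ Suc n / fact (Suc n))"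
    unfolding derangement_number_def sum.atMost_Suc distrib_left ..
  also have "fact (Suc n) * ((-1) ^ Suc n / fact (Suc n)) = (-1 :: real) ^ Suc n"
    by (simp del: fact_Suc)
  finally show ?thesis
    by (simp add: derangement_number_def mult.assoc)
qed

lemma sum_Stirling_derangement_Suc:
  "(\<Sum>k\<le>Suc n. real (Stirling (Suc n) k) * (-1) ^ k * derangement_number k)
    = real (bell n) - (\<Sum>k\<le>n. real (Stirling n k) * (-1) ^ k * derangement_number k)"
proof -
  define d where "d k = (-1) ^ k * derangement_number k" for k
  have d: "real k * d k + d (Suc k) = 1 - d k" for k
    by (simp add: d_def derangement_number_Suc algebra_simps flip: power_add mult_2)
  have "(\<Sum>k\<le>Suc n. real (Stirling (Suc n) k) * d k)
      = real (bell n) - (\<Sum>k\<le>n. real (Stirling n k) * d k)"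
    unfolding sum_Stirling_Suc d bell_def by (simp add: right_diff_distrib sum_subtractf)
  then show ?thesis
    by (simp only: d_def mult.assoc)
qed

lemma sum_Stirling_derangement:
  "(-1) ^ n * (\<Sum>k\<le>n. real (Stirling n k) * (-1) ^ k * derangement_number k)
    = 1 + (\<Sum>j<n. (-1) ^ (j + 1) * real (bell j))"
proof (induction n)
  case 0
  then show ?case by (simp add: derangement_number_def)
next
  case (Suc n)
  then show ?case
    \<comment> \<open>The extra sign \<open>(-1) ^ Suc n\<close> cancels the minus in front of the
      old sum, so each step only adds \<open>(-1) ^ Suc n * real (bell n)\<close>.\<close>
    unfolding sum_Stirling_derangement_Suc by (simp add: right_diff_distrib)
qed

text \<open>Pascal's rule: an iterated difference of order \<open>Suc n\<close> is one of order
  \<open>n\<close> applied to the first difference of \<open>f\<close>.\<close>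

lemma alternating_binomial_sum_Suc:
  fixes f :: "nat \<Rightarrow> 'a::comm_ring_1"
  shows "(\<Sum>k\<le>Suc n. of_nat (Suc n choose k) * (-1) ^ k * f k)
    = (\<Sum>k\<le>n. of_nat (n choose k) * (-1) ^ k * (f k - f (Suc k)))"
proof -
  have "(\<Sum>k\<le>Suc n. of_nat (Suc n choose k) * (-1) ^ k * f k)
      = f 0 + (\<Sum>k\<le>n. of_nat (n choose Suc k) * (-1) ^ Suc k * f (Suc k))
        - (\<Sum>k\<le>n. of_nat (n choose k) * (-1) ^ k * f (Suc k))"
    by (subst sum.atMost_Suc_shift)
      (simp add: algebra_simps sum.distrib sum_negf sum_subtractf)
  also have "f 0 + (\<Sum>k\<le>n. of_nat (n choose Suc k) * (-1) ^ Suc k * f (Suc k))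
      = (\<Sum>k\<le>Suc n. of_nat (n choose k) * (-1) ^ k * f k)"
    by (subst sum.atMost_Suc_shift) simp
  also have "\<dots> = (\<Sum>k\<le>n. of_nat (n choose k) * (-1) ^ k * f k)"
    by (simp add: binomial_eq_0)
  finally show ?thesis
    by (simp add: right_diff_distrib sum_subtractf)
qed

text \<open>Up to the sign \<open>(-1) ^ n\<close>, the left side obeys the Stirling recurrence in
  \<open>n\<close> and \<open>m\<close>. This recurrence also calls on the predecessor of
  \<open>m\<close>, so \<open>m\<close> stays arbitrary in the induction.\<close>

lemma alternating_binomial_sum_Stirling:
  "(\<Sum>k\<le>n. of_nat (n choose k) * (-1) ^ k * of_nat (Stirling (Suc k) (Suc m)))
    = ((-1) ^ n * of_nat (Stirling n m) :: 'a::comm_ring_1)"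
proof (induction n arbitrary: m)
  case 0
  then show ?case by (cases m) simp_all
next
  case (Suc n)
  show ?case
  proof (cases m)
    \<comment> \<open>\<open>Stirling (Suc k) 1 = 1\<close> for all \<open>k\<close>, so every first
      difference vanishes, matching \<open>Stirling (Suc n) 0 = 0\<close>.\<close>
    case 0
    then show ?thesis
      unfolding alternating_binomial_sum_Suc by simp
  next
    case (Suc l)
    \<comment> \<open>Subtraction lowers the recurrence's factor \<open>Suc m\<close> to
      \<open>m\<close>, exactly the factor in the recurrence for
      \<open>Stirling (Suc n) m\<close>.\<close>
    have "of_nat (Stirling (Suc k) (Suc m)) - of_nat (Stirling (Suc (Suc k)) (Suc m))
        = - (of_nat m * of_nat (Stirling (Suc k) (Suc m))
            + of_nat (Stirling (Suc k) (Suc l)) :: 'a)" for k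
      unfolding Stirling.simps(4)[of "Suc k"] using Suc
      by (simp add: algebra_simps del: Stirling.simps)
    then have "(\<Sum>k\<le>Suc n. of_nat (Suc n choose k) * (-1) ^ k * of_nat (Stirling (Suc k) (Suc m)))
        = - (of_nat m * (\<Sum>k\<le>n. of_nat (n choose k) * (-1) ^ k * of_nat (Stirling (Suc k) (Suc m)))
          + (\<Sum>k\<le>n. of_nat (n choose k) * (-1) ^ k * of_nat (Stirling (Suc k) (Suc l))) :: 'a)"
      unfolding alternating_binomial_sum_Suc
      by (simp add: sum_distrib_left sum.distrib sum_negf sum_subtractf
        right_diff_distrib mult_ac del: Stirling.simps)
    also have "\<dots> = (-1) ^ Suc n * of_nat (Stirling (Suc n) m)"
      unfolding Suc.IH using Suc by (simp add: algebra_simps)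
    finally show ?thesis .
  qed
qed

text \<open>Padding with zero terms makes the range of \<open>m\<close> independent of
  \<open>k\<close>, which allows the double sum over \<open>k\<close> and \<open>m\<close> to be
  swapped.\<close>

lemma bell_Suc_eq_sum:
  assumes "k \<le> n"
  shows "bell (Suc k) = (\<Sum>m\<le>n. Stirling (Suc k) (Suc m))"
proof -
  have "bell (Suc k) = (\<Sum>m\<le>k. Stirling (Suc k) (Suc m))"
    unfolding bell_def by (subst sum.atMost_Suc_shift) simp
  also have "\<dots> = (\<Sum>m\<le>n. Stirling (Suc k) (Suc m))"
    using assms by (intro sum.mono_neutral_left) (auto simp del: Stirling.simps)
  finally show ?thesis .
qed

lemma alternating_binomial_sum_bell_Suc:
  "(\<Sum>k\<le>n. of_nat (n choose k) * (-1) ^ k * of_nat (bell (Suc k)))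
    = ((-1) ^ n * of_nat (bell n) :: 'a::comm_ring_1)"
proof -
  have "(\<Sum>k\<le>n. of_nat (n choose k) * (-1) ^ k * of_nat (bell (Suc k)))
      = (\<Sum>k\<le>n. \<Sum>m\<le>n. of_nat (n choose k) * (-1) ^ k * of_nat (Stirling (Suc k) (Suc m)) :: 'a)"
    by (intro sum.cong refl)
      (simp add: bell_Suc_eq_sum sum_distrib_left del: Stirling.simps)
  also have "\<dots> = (\<Sum>m\<le>n. (-1) ^ n * of_nat (Stirling n m))"
    by (subst sum.swap) (simp only: alternating_binomial_sum_Stirling)
  finally show ?thesis
    by (simp add: bell_def sum_distrib_left)
qed

lemma alternating_binomial_sum_bell:
  "(\<Sum>k\<le>n. of_nat (n choose k) * (-1) ^ k * of_nat (bell k))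
    = (1 + (\<Sum>j<n. (-1) ^ (j + 1) * of_nat (bell j)) :: 'a::comm_ring_1)"
proof (induction n)
  case 0
  then show ?case by (simp add: bell_def)
next
  case (Suc n)
  then show ?case
    unfolding alternating_binomial_sum_Suc right_diff_distrib sum_subtractf
      alternating_binomial_sum_bell_Suc by simp
qed

theorem theorem15:
  fixes n :: nat
  shows "(-1) ^ n * (\<Sum>k\<le>n. real (Stirling n k) * (-1) ^ k * derangement_number k)
           = (\<Sum>k\<le>n. real (n choose k) * (-1) ^ k * real (bell k))
       \<and> (\<Sum>k\<le>n. real (n choose k) * (-1) ^ k * real (bell k))
           = 1 + (\<Sum>j<n. (-1) ^ (j + 1) * real (bell j))"
  unfolding sum_Stirling_derangement alternating_binomial_sum_bell by simp

end
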